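(* Let $G_1,G_2,\ldots$ be an infinite sequence of finite simple regular graphs, where $G_k$ is regular of degree $d(G_k)$, and suppose that $d(G_k)\rightarrow+\infty$ as $k\rightarrow+\infty$. Let $\alpha>1$ and $c>0$ be constants such that $i(G_k)\sim c\,\alpha^{d(G_k)}$ as $k\to+\infty$, and let $p$ be a fixed real number with $0\le p\le 1$ and $p>1/\alpha$. Then $$t_e(G_k,p)\rightarrow 0\quad\text{as}\quad k\rightarrow+\infty.$$
   Context: Graphs are finite, simple and undirected. A graph is $d$-regular (regular of degree $d$) if every vertex has exactly $d$ adjacent vertices. The independence number $i(G)$ is the maximum number of pairwise non-adjacent vertices in $G$. For a graph $G$ and a real number $p$ with $0\le p\le 1$, the edge-fault (EF) tolerance $t_e(G,p)$ is the probability that $G$ is connected when all vertices are perfectly reliable and each edge fails (is deleted) independently with probability $p$; that is, the probability that the random spanning subgraph of $G$ (on the full vertex set) formed by the non-failed edges is connected. The notation $a_k\sim b_k$ means $a_k/b_k\to 1$ as $k\to+\infty$. *)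

theory Defs
  imports
    "Graph_Theory.Pair_Digraph"
    "Graph_Theory.Digraph_Component"
    "HOL-Probability.Product_PMF"
    "HOL-Library.Landau_Symbols"
begin

text \<open>
  A finite simple undirected graph is a \<^locale>\<open>pair_graph\<close>: a finite, loop-free and symmetric
  set of arcs. Each undirected edge is thus a pair of opposite arcs, and edges that fail as a
  unit have to be represented as two-element vertex sets.
\<close>

definition undirected_edges :: "'a pair_pre_digraph \<Rightarrow> 'a set set" where
  "undirected_edges G = {{u, v} | u v. (u, v) \<in> parcs G}"

definition regular_of_degree :: "'a pair_pre_digraph \<Rightarrow> nat \<Rightarrow> bool" where
  "regular_of_degree G d \<longleftrightarrow> (\<forall>u \<in> pverts G. card {v \<in> pverts G. (u, v) \<in> parcs G} = d)"

definition independent_set :: "'a pair_pre_digraph \<Rightarrow> 'a set \<Rightarrow> bool" where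
  "independent_set G S \<longleftrightarrow> S \<subseteq> pverts G \<and> pairwise (\<lambda>u v. (u, v) \<notin> parcs G) S"

definition independence_number :: "'a pair_pre_digraph \<Rightarrow> nat" where
  "independence_number G = Max {card S | S. independent_set G S}"

definition delete_edges :: "'a pair_pre_digraph \<Rightarrow> 'a set set \<Rightarrow> 'a pair_pre_digraph" where
  "delete_edges G F =
     \<lparr> pverts = pverts G, parcs = {(u, v). (u, v) \<in> parcs G \<and> {u, v} \<notin> F} \<rparr>"

text \<open>
  In the sample \<open>X\<close>, \<open>X e\<close> means that the edge \<open>e\<close> fails. Connectedness is
  qualified because the unqualified name may denote the topological notion.
\<close>

definition edge_fault_tolerance :: "'a pair_pre_digraph \<Rightarrow> real \<Rightarrow> real" where
  "edge_fault_tolerance G p =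
     measure_pmf.prob (Pi_pmf (undirected_edges G) False (\<lambda>_. bernoulli_pmf p))
       {X. Digraph_Component.connected (with_proj (delete_edges G {e \<in> undirected_edges G. X e}))}"

end

theory Submission
  imports Defs
begin

text \<open>
  A connected graph on more than one vertex has no isolated vertex. Hence, if \<open>G\<close> has positive
  degree and stays connected, then every vertex keeps at least one of its incident edges. It
  suffices to test this on a maximum independent set \<open>S\<close>: its members are pairwise non-adjacent,
  so the sets of edges incident to them are disjoint, and the events that they become isolated
  are independent (\<open>prob_no_block_all_true\<close>), each of probability \<open>p ^ d\<close>. Therefore
  \<open>edge_fault_tolerance G p \<le> (1 - p ^ d) ^ n \<le> exp (- n * p ^ d)\<close>, where \<open>n\<close> is the
  independence number; the first inequality is \<open>edge_fault_tolerance_le\<close>. Since \<open>n * p ^ d\<close> is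
  asymptotically equivalent to \<open>c * (\<alpha> * p) ^ d\<close> and \<open>\<alpha> * p > 1\<close>, it diverges.
\<close>

section \<open>Independence of disjoint blocks of coordinates\<close>

lemma prob_no_block_all_true:
  assumes fin: "finite A" "finite S"
    and sub: "\<And>v. v \<in> S \<Longrightarrow> B v \<subseteq> A"
    and disj: "disjoint_family_on B S"
  shows "measure_pmf.prob (Pi_pmf A dflt P) {X. \<forall>v\<in>S. \<exists>e\<in>B v. \<not> X e} =
           (\<Prod>v\<in>S. 1 - (\<Prod>e\<in>B v. pmf (P e) True))"
proof (cases "S = {}")
  case False
  define M where "M = measure_pmf (Pi_pmf A dflt P)"
  interpret prob_space M
    unfolding M_def by (rule measure_pmf.prob_space_axioms)
  have space_M [simp]: "space M = UNIV" and sets_M [simp]: "sets M = UNIV"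
    by (simp_all add: M_def)
  have finB: "finite (B v)" if "v \<in> S" for v
    using finite_subset[OF sub[OF that] fin(1)] .
  have "indep_vars (\<lambda>_. count_space UNIV) (\<lambda>e X. X e) A"
    unfolding M_def by (rule indep_vars_Pi_pmf[OF fin(1)])
  then have "indep_vars (\<lambda>v. PiM (B v) (\<lambda>_. count_space UNIV))
               (\<lambda>v X. restrict (\<lambda>e. X e) (B v)) S"
    by (rule indep_vars_restrict[OF _ sub disj])
  moreover have "{f \<in> space (PiM (B v) (\<lambda>_. count_space UNIV)). \<exists>e\<in>B v. \<not> f e}
                  \<in> sets (PiM (B v) (\<lambda>_. count_space UNIV))" if "v \<in> S" for v
    using finB[OF that] by measurable
  ultimately have "indep_events
      (\<lambda>v. {X \<in> space M. \<exists>e\<in>B v. \<not> restrict (\<lambda>e. X e) (B v) e}) S"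
    by (rule indep_eventsI_indep_vars)
  then have "prob (\<Inter>v\<in>S. {X. \<exists>e\<in>B v. \<not> X e}) = (\<Prod>v\<in>S. prob {X. \<exists>e\<in>B v. \<not> X e})"
    using False fin(2) by (auto simp: indep_events_def)
  also have "\<dots> = (\<Prod>v\<in>S. 1 - (\<Prod>e\<in>B v. pmf (P e) True))"
  proof (rule prod.cong[OF refl])
    fix v assume v: "v \<in> S"
    have "{X. \<forall>e\<in>B v. X e} = Pi A (\<lambda>e. if e \<in> B v then {True} else UNIV)"
      using sub[OF v] by (auto simp: Pi_def)
    then have "prob {X. \<forall>e\<in>B v. X e} =
        (\<Prod>e\<in>A. measure_pmf.prob (P e) (if e \<in> B v then {True} else UNIV))"
      unfolding M_def by (simp add: measure_Pi_pmf_Pi[OF fin(1)])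
    also have "\<dots> = (\<Prod>e\<in>B v. pmf (P e) True)"
      by (rule prod.mono_neutral_cong_right[OF fin(1) sub[OF v]])
         (auto simp: measure_pmf_single)
    finally have all: "prob {X. \<forall>e\<in>B v. X e} = (\<Prod>e\<in>B v. pmf (P e) True)" .
    have "{X. \<exists>e\<in>B v. \<not> X e} = space M - {X. \<forall>e\<in>B v. X e}"
      by auto
    then have "prob {X. \<exists>e\<in>B v. \<not> X e} = 1 - prob {X. \<forall>e\<in>B v. X e}"
      by (simp only: prob_compl sets_M UNIV_I)
    with all show "prob {X. \<exists>e\<in>B v. \<not> X e} = 1 - (\<Prod>e\<in>B v. pmf (P e) True)"
      by simp
  qed
  finally show ?thesis
    unfolding M_def by (simp add: Collect_ball_eq)
qed simp

section \<open>Isolated vertices of an independent set\<close>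

lemma ex_maximum_independent_set:
  assumes "finite (pverts G)"
  shows "\<exists>S. independent_set G S \<and> card S = independence_number G"
proof -
  have "finite {card S | S. independent_set G S}"
    using finite_subset[of "{S. independent_set G S}" "Pow (pverts G)"] assms
    by (auto simp: independent_set_def)
  moreover have "independent_set G {}"
    by (simp add: independent_set_def)
  ultimately have "independence_number G \<in> {card S | S. independent_set G S}"
    unfolding independence_number_def by (intro Max_in) auto
  then show ?thesis
    by auto
qed

definition incident_edges :: "'a pair_pre_digraph \<Rightarrow> 'a \<Rightarrow> 'a set set" where
  "incident_edges G v = (\<lambda>w. {v, w}) ` {w \<in> pverts G. (v, w) \<in> parcs G}"

lemma incident_edges_subset: "incident_edges G v \<subseteq> undirected_edges G"
  by (auto simp: incident_edges_def undirected_edges_def)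

lemma card_incident_edges:
  assumes "regular_of_degree G d" "v \<in> pverts G"
  shows "card (incident_edges G v) = d"
proof -
  have "inj_on (\<lambda>w. {v, w}) {w \<in> pverts G. (v, w) \<in> parcs G}"
    by (auto simp: inj_on_def doubleton_eq_iff)
  then show ?thesis
    using assms by (simp add: incident_edges_def card_image regular_of_degree_def)
qed

lemma disjoint_incident_edges:
  assumes "independent_set G S"
  shows "disjoint_family_on (incident_edges G) S"
  using assms
  by (auto simp: disjoint_family_on_def incident_edges_def independent_set_def pairwise_def
      doubleton_eq_iff)

text \<open>
  The hypothesis that some edge of \<open>G\<close> starts at \<open>v\<close> serves to provide a second vertex, which a
  connected subgraph must reach from \<open>v\<close>: the graph on the single vertex \<open>v\<close> is connected.
\<close>

lemma connected_imp_incident_edge_survives: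
  assumes "pair_graph G"
    and conn: "Digraph_Component.connected (with_proj (delete_edges G F))"
    and v: "(v, w) \<in> parcs G"
  shows "\<exists>e \<in> incident_edges G v. e \<notin> F"
proof -
  interpret pair_graph G by fact
  let ?H = "mk_symmetric (with_proj (delete_edges G F))"
  have "v \<in> pverts G" "w \<in> pverts G" "v \<noteq> w"
    using v in_arcsD1 in_arcsD2 no_loops' by auto
  then have "v \<rightarrow>\<^sup>*\<^bsub>with_proj ?H\<^esub> w"
    using conn by (simp add: connected_def strongly_connected_def delete_edges_def)
  then obtain u where "(v, u) \<in> parcs ?H"
    using \<open>v \<noteq> w\<close> by (cases rule: pre_digraph.converse_reachable_cases) auto
  then have "(v, u) \<in> parcs G" "{v, u} \<notin> F"
    using arcs_symmetric by (auto simp: parcs_mk_symmetric delete_edges_def insert_commute)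
  then show ?thesis
    using in_arcsD2 by (auto simp: incident_edges_def)
qed

lemma edge_fault_tolerance_le:
  assumes G: "pair_graph G" and reg: "regular_of_degree G d" and "d > 0"
    and S: "independent_set G S" and p: "0 \<le> p" "p \<le> 1"
  shows "edge_fault_tolerance G p \<le> (1 - p ^ d) ^ card S"
proof -
  interpret pair_graph G by fact
  let ?P = "Pi_pmf (undirected_edges G) False (\<lambda>_. bernoulli_pmf p)"
  have SV: "S \<subseteq> pverts G"
    using S by (simp add: independent_set_def)
  then have finS: "finite S"
    using finite_subset[OF _ pair_finite_verts] by blast
  have "undirected_edges G = (\<lambda>(u, v). {u, v}) ` parcs G"
    by (auto simp: undirected_edges_def)
  then have finE: "finite (undirected_edges G)"
    using pair_finite_arcs by simp
  have "edge_fault_tolerance G p \<le>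
          measure_pmf.prob ?P {X. \<forall>v\<in>S. \<exists>e\<in>incident_edges G v. \<not> X e}"
    unfolding edge_fault_tolerance_def
  proof (rule measure_pmf.finite_measure_mono, clarsimp)
    fix X v
    assume conn: "Digraph_Component.connected
                    (with_proj (delete_edges G {e \<in> undirected_edges G. X e}))"
      and "v \<in> S"
    then have "card {w \<in> pverts G. (v, w) \<in> parcs G} > 0"
      using SV reg \<open>d > 0\<close> by (auto simp: regular_of_degree_def)
    then obtain w where "(v, w) \<in> parcs G"
      by (auto simp: card_gt_0_iff)
    from connected_imp_incident_edge_survives[OF G conn this]
    show "\<exists>e\<in>incident_edges G v. \<not> X e"
      using incident_edges_subset[of G v] by auto
  qed simp
  also have "\<dots> = (\<Prod>v\<in>S. 1 - (\<Prod>e\<in>incident_edges G v. pmf (bernoulli_pmf p) True))"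
    by (rule prob_no_block_all_true[OF finE finS incident_edges_subset disjoint_incident_edges[OF S]])
  also have "\<dots> = (\<Prod>v\<in>S. 1 - p ^ d)"
    using SV p by (intro prod.cong) (auto simp: card_incident_edges[OF reg])
  finally show ?thesis
    by simp
qed

section \<open>The limit\<close>

theorem mainTheorem2:
  fixes G :: "nat \<Rightarrow> 'a pair_pre_digraph" and d :: "nat \<Rightarrow> nat" and \<alpha> c p :: real
  assumes graph: "\<And>k. k \<ge> 1 \<Longrightarrow> pair_graph (G k)"
    and regular: "\<And>k. k \<ge> 1 \<Longrightarrow> regular_of_degree (G k) (d k)"
    and degree_at_top: "filterlim d at_top sequentially"
    and "\<alpha> > 1" and "c > 0"
    and independence: "(\<lambda>k. real (independence_number (G k))) \<sim>[sequentially] (\<lambda>k. c * \<alpha> ^ d k)"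
    and "0 \<le> p" and "p \<le> 1" and "p > 1 / \<alpha>"
  shows "(\<lambda>k. edge_fault_tolerance (G k) p) \<longlonglongrightarrow> 0"
proof -
  let ?i = "\<lambda>k. independence_number (G k)"
  have "\<alpha> * p > 1"
    using \<open>\<alpha> > 1\<close> \<open>p > 1 / \<alpha>\<close> by (simp add: field_simps)
  then have "filterlim (\<lambda>n. (\<alpha> * p) ^ n) at_top sequentially"
    by (intro filterlim_at_infinity_imp_filterlim_at_top filterlim_realpow_sequentially_gt1) auto
  then have "filterlim (\<lambda>k. c * (\<alpha> * p) ^ d k) at_top sequentially"
    by (intro filterlim_tendsto_pos_mult_at_top[OF tendsto_const \<open>c > 0\<close>]
        filterlim_compose[OF _ degree_at_top])
  moreover have "(\<lambda>k. real (?i k) * p ^ d k) \<sim>[sequentially] (\<lambda>k. c * (\<alpha> * p) ^ d k)"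
    using asymp_equiv_mult[OF independence asymp_equiv_refl[of "\<lambda>k. p ^ d k"]]
    by (simp add: power_mult_distrib mult.assoc)
  ultimately have expo: "filterlim (\<lambda>k. real (?i k) * p ^ d k) at_top sequentially"
    using asymp_equiv_at_top_transfer asymp_equiv_sym by blast
  have lim: "(\<lambda>k. exp (- (real (?i k) * p ^ d k))) \<longlonglongrightarrow> 0"
    by (rule filterlim_compose[OF exp_at_bot])
       (use expo in \<open>simp add: filterlim_uminus_at_bot\<close>)
  have "edge_fault_tolerance (G k) p \<le> exp (- (real (?i k) * p ^ d k))"
    if "k \<ge> 1" "d k > 0" for k
  proof -
    interpret pair_graph "G k"
      using graph that by blast
    obtain S where S: "independent_set (G k) S" "card S = ?i k"
      using ex_maximum_independent_set[OF pair_finite_verts] by blast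
    have "edge_fault_tolerance (G k) p \<le> (1 - p ^ d k) ^ ?i k"
      using edge_fault_tolerance_le[OF graph[of k] regular[of k] _ S(1)] that S(2)
        \<open>0 \<le> p\<close> \<open>p \<le> 1\<close> by auto
    also have "\<dots> \<le> exp (- (p ^ d k)) ^ ?i k"
      using exp_ge_add_one_self[of "- (p ^ d k)"] \<open>0 \<le> p\<close> \<open>p \<le> 1\<close>
      by (intro power_mono) (auto simp: power_le_one)
    also have "\<dots> = exp (- (real (?i k) * p ^ d k))"
      by (simp flip: exp_of_nat_mult)
    finally show ?thesis .
  qed
  moreover have "eventually (\<lambda>k. k \<ge> 1 \<and> d k > 0) sequentially"
    using eventually_ge_at_top[of 1] degree_at_top[unfolded filterlim_at_top, rule_format, of 1]
    by eventually_elim auto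
  ultimately have "eventually (\<lambda>k. edge_fault_tolerance (G k) p
                     \<le> exp (- (real (?i k) * p ^ d k))) sequentially"
    by (auto elim: eventually_mono)
  then show ?thesis
    by (intro tendsto_sandwich[OF _ _ tendsto_const lim])
       (auto simp: edge_fault_tolerance_def)
qed

end
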